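(* Let $L$ be a curve in three-dimensional Euclidean space having the parametric equation $x=x(t),\ y=y(t),\ z=z(t)$, and let $A=(x(t_0),y(t_0),z(t_0))\in L$. Set $\Delta t=t-t_0$, $\Delta x=x(t)-x(t_0)$, $\Delta y=y(t)-y(t_0)$, $\Delta z=z(t)-z(t_0)$. Then $L$ has the tangent at $A$ if and only if both of the limits $$\lim_{\Delta t\to 0^+}\frac{1}{\sqrt{\left(\frac{\Delta x}{\Delta t}\right)^2+\left(\frac{\Delta y}{\Delta t}\right)^2+\left(\frac{\Delta z}{\Delta t}\right)^2}}\left(\frac{\Delta x}{\Delta t},\frac{\Delta y}{\Delta t},\frac{\Delta z}{\Delta t}\right)$$ and $$\lim_{\Delta t\to 0^-}\frac{1}{\sqrt{\left(\frac{\Delta x}{\Delta t}\right)^2+\left(\frac{\Delta y}{\Delta t}\right)^2+\left(\frac{\Delta z}{\Delta t}\right)^2}}\left(\frac{\Delta x}{\Delta t},\frac{\Delta y}{\Delta t},\frac{\Delta z}{\Delta t}\right)$$ exist (in $\mathbb{R}^3$) and these two vectors are collinear.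
   Context: Definition of tangent. Let $L$ be a curve in space and $A\in L$. Consider an arc of $L$ containing $A$ which is divided by $A$ into two parts $L_1$ and $L_2$ such that $L_1$ and $L_2$ intersect only at $A$, and each part contains points different from $A$. For $M\in L$, $M\neq A$, the secant line $AM$ has the unit vector $\overrightarrow{AM}/|\overrightarrow{AM}|$. If the limits $$\lim_{M\to A,\ M\in L_1}\frac{\overrightarrow{AM}}{|\overrightarrow{AM}|}\quad\text{and}\quad \lim_{M\to A,\ M\in L_2}\frac{\overrightarrow{AM}}{|\overrightarrow{AM}|}$$ (taken over $M\ne A$) exist and are collinear vectors, then $L$ is said to have the tangent at $A$, and both limits are direction vectors of this tangent. Conventions for a parametrized curve. The functions $x(t),y(t),z(t)$ are continuous real-valued functions on an open interval containing $t_0$. The arc in the definition of tangent is the image of an interval $[t_0-\delta,t_0+\delta]$, $\delta>0$, contained in the domain, with $L_1$ the image of $[t_0,t_0+\delta]$ and $L_2$ the image of $[t_0-\delta,t_0]$. It is assumed, as the definition requires, that $\delta$ is such that $L_1\cap L_2=\{A\}$, and that $(x(t),y(t),z(t))\neq A$ for $0<|t-t_0|\le\delta$ (so that the displayed quotients are defined). Two vectors are collinear if they are linearly dependent. *)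

theory Defs
  imports "HOL-Analysis.Analysis"
begin

definition space_curve :: "(real \<Rightarrow> real) \<Rightarrow> (real \<Rightarrow> real) \<Rightarrow> (real \<Rightarrow> real) \<Rightarrow> real \<Rightarrow> real^3" where
  "space_curve x y z t = vector [x t, y t, z t]"

(* Linear dependence of the pair (u, v) as a family; dependent {u, v} would
   wrongly exclude u = v, since it sees a one-element set. *)
definition collinear_vectors :: "'a::real_vector \<Rightarrow> 'a \<Rightarrow> bool" where
  "collinear_vectors u v \<longleftrightarrow> (\<exists>a b :: real. (a \<noteq> 0 \<or> b \<noteq> 0) \<and> a *\<^sub>R u + b *\<^sub>R v = 0)"

definition secant_direction :: "'a::real_normed_vector \<Rightarrow> 'a \<Rightarrow> 'a" where
  "secant_direction A M = (M - A) /\<^sub>R norm (M - A)"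

(* An arc is the continuous image of a compact parameter interval; it need not
   be injective. The point A cuts the arc p ` {a..b} at the parameter c. *)
definition divides_arc :: "(real^3) set \<Rightarrow> real^3 \<Rightarrow> (real^3) set \<Rightarrow> (real^3) set \<Rightarrow> bool" where
  "divides_arc L A L1 L2 \<longleftrightarrow>
     (\<exists>(p :: real \<Rightarrow> real^3) a b c.
        a \<le> c \<and> c \<le> b \<and> continuous_on {a..b} p \<and> p ` {a..b} \<subseteq> L \<and>
        p c = A \<and> L1 = p ` {c..b} \<and> L2 = p ` {a..c}) \<and>
     L1 \<inter> L2 = {A} \<and> (\<exists>M\<in>L1. M \<noteq> A) \<and> (\<exists>M\<in>L2. M \<noteq> A)"

(* L has the tangent at A, as judged on the arc of L whose two parts at A are
   L1 and L2. The arc is an explicit argument because L may pass through A more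
   than once. The filter at A within L1 ranges over points M of L1 with M \<noteq> A. *)
definition has_tangent_at :: "(real^3) set \<Rightarrow> real^3 \<Rightarrow> (real^3) set \<Rightarrow> (real^3) set \<Rightarrow> bool" where
  "has_tangent_at L A L1 L2 \<longleftrightarrow>
     divides_arc L A L1 L2 \<and>
     (\<exists>u v. (secant_direction A \<longlongrightarrow> u) (at A within L1) \<and>
            (secant_direction A \<longlongrightarrow> v) (at A within L2) \<and>
            collinear_vectors u v)"

(* The expression under the two limits of the criterion; dt is the increment
   of the parameter. *)
definition normalized_difference_quotient ::
  "(real \<Rightarrow> real) \<Rightarrow> (real \<Rightarrow> real) \<Rightarrow> (real \<Rightarrow> real) \<Rightarrow> real \<Rightarrow> real \<Rightarrow> real^3" where
  "normalized_difference_quotient x y z t0 dt =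
     (let qx = (x (t0 + dt) - x t0) / dt;
          qy = (y (t0 + dt) - y t0) / dt;
          qz = (z (t0 + dt) - z t0) / dt
      in (1 / sqrt (qx\<^sup>2 + qy\<^sup>2 + qz\<^sup>2)) *\<^sub>R vector [qx, qy, qz])"

end

theory Submission
  imports Defs
begin

text \<open>
  The criterion is a change of variable in a limit. Along either half of the arc, \<open>M\<close> approaches
  \<open>A\<close> exactly when the parameter of \<open>M\<close> approaches \<open>t0\<close>. One half of this equivalence is continuity
  of the parametrization. The other half is compactness: the parameters that stay away from \<open>t0\<close>
  form a compact set, its image is a compact set that misses \<open>A\<close>, and so points close to \<open>A\<close> have
  all their parameters close to \<open>t0\<close>, even if the parametrization is not injective. Lemma
  \<open>filtermap_at_within_compact\<close> states this as an equality of filters, so that it transports limits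
  in both directions.

  It remains to compare the two expressions under the limits. The quotient of the criterion is the
  unit vector of the secant vector divided by \<open>\<Delta>t\<close>, hence it is the secant direction multiplied by
  the sign of \<open>\<Delta>t\<close> (lemma \<open>normalized_difference_quotient_eq\<close>). The two right-hand limits agree
  and the two left-hand limits are opposite to each other, which does not affect collinearity.
\<close>

text \<open>
  The inclusion of the right-hand side in the left-hand side is where compactness enters: outside a
  neighbourhood \<open>U\<close> of \<open>c\<close> the values of \<open>p\<close> form a closed set \<open>p ` (S - U)\<close>, and its complement is
  a neighbourhood of \<open>p c\<close>.
\<close>

lemma filtermap_at_within_compact:
  fixes p :: "'a::topological_space \<Rightarrow> 'b::t2_space"
  assumes "compact S" and cont: "continuous_on S p" and "c \<in> S"
    and avoid: "\<And>t. t \<in> S \<Longrightarrow> t \<noteq> c \<Longrightarrow> p t \<noteq> p c"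
  shows "filtermap p (at c within S) = at (p c) within p ` S"
proof (rule antisym)
  have "filterlim p (at (p c) within p ` S) (at c within S)"
    unfolding filterlim_at
    using cont avoid \<open>c \<in> S\<close> by (auto simp: continuous_on_def eventually_at_filter)
  then show "filtermap p (at c within S) \<le> at (p c) within p ` S"
    by (simp add: filterlim_def)
next
  show "at (p c) within p ` S \<le> filtermap p (at c within S)"
  proof (rule filter_leI)
    fix P
    assume "eventually P (filtermap p (at c within S))"
    then obtain U where U: "open U" "c \<in> U" "\<And>t. t \<in> U \<Longrightarrow> t \<noteq> c \<Longrightarrow> t \<in> S \<Longrightarrow> P (p t)"
      by (auto simp: eventually_filtermap eventually_at_topological)
    have "compact (S - U)"
      using \<open>compact S\<close> \<open>open U\<close> by (rule compact_diff)
    then have "compact (p ` (S - U))"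
      using cont by (meson Diff_subset compact_continuous_image continuous_on_subset)
    then have "open (- p ` (S - U))"
      by (simp add: compact_imp_closed open_Compl)
    moreover have "p c \<in> - p ` (S - U)"
      using avoid U(2) by (metis ComplI DiffE imageE)
    moreover have "P M" if "M \<in> - p ` (S - U)" "M \<noteq> p c" "M \<in> p ` S" for M
      using that U(3) by blast
    ultimately show "eventually P (at (p c) within p ` S)"
      unfolding eventually_at_topological by blast
  qed
qed

lemma filterlim_compose_at_within_compact:
  fixes p :: "'a::topological_space \<Rightarrow> 'b::t2_space"
  assumes "compact S" "continuous_on S p" "c \<in> S"
    and "\<And>t. t \<in> S \<Longrightarrow> t \<noteq> c \<Longrightarrow> p t \<noteq> p c"
  shows "filterlim f F (at (p c) within p ` S) \<longleftrightarrow> filterlim (\<lambda>t. f (p t)) F (at c within S)"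
  by (simp add: filtermap_at_within_compact[OF assms, symmetric] filterlim_filtermap)

lemma secant_direction_eq_sgn: "secant_direction A M = sgn (M - A)"
  by (simp add: secant_direction_def sgn_div_norm)

lemma norm_vector_3: "norm (vector [a, b, c] :: real^3) = sqrt (a\<^sup>2 + b\<^sup>2 + c\<^sup>2)"
  by (simp add: norm_vec_def L2_set_def sum_3)

lemma continuous_on_space_curve:
  assumes "continuous_on S x" "continuous_on S y" "continuous_on S z"
  shows "continuous_on S (space_curve x y z)"
proof -
  have "space_curve x y z = (\<lambda>t. \<chi> i. if i = 1 then x t else if i = 2 then y t else z t)"
    by (auto simp: space_curve_def vec_eq_iff forall_3 fun_eq_iff)
  moreover have "continuous_on S (\<lambda>t. if i = 1 then x t else if i = 2 then y t else z t)" for i :: 3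
    using assms by (cases "i = 1"; cases "i = 2") auto
  ultimately show ?thesis
    by (simp add: continuous_on_vec_lambda)
qed

text \<open>
  The square root in the quotient is a norm, so the whole expression is the sign of the vector of
  difference quotients. Since \<open>sgn\<close> is multiplicative for scaling, the factor \<open>1 / dt\<close> survives only
  through its sign.
\<close>

lemma normalized_difference_quotient_eq:
  "normalized_difference_quotient x y z t0 dt =
     sgn dt *\<^sub>R secant_direction (space_curve x y z t0) (space_curve x y z (t0 + dt))"
proof -
  define q where "q = (space_curve x y z (t0 + dt) - space_curve x y z t0) /\<^sub>R dt"
  have "q = vector [(x (t0 + dt) - x t0) / dt, (y (t0 + dt) - y t0) / dt, (z (t0 + dt) - z t0) / dt]"
    by (simp add: q_def space_curve_def vec_eq_iff forall_3 divide_inverse_commute)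
  then have "normalized_difference_quotient x y z t0 dt = sgn q"
    by (simp add: normalized_difference_quotient_def Let_def sgn_div_norm norm_vector_3 inverse_eq_divide)
  also have "\<dots> = sgn dt *\<^sub>R secant_direction (space_curve x y z t0) (space_curve x y z (t0 + dt))"
    by (simp add: q_def sgn_scaleR secant_direction_eq_sgn)
  finally show ?thesis .
qed

lemma collinear_vectors_minus_right: "collinear_vectors u (- v) \<longleftrightarrow> collinear_vectors u v"
proof -
  have "collinear_vectors u (- w)" if "collinear_vectors u w" for w :: 'a
  proof -
    obtain a b :: real where "a \<noteq> 0 \<or> b \<noteq> 0" "a *\<^sub>R u + b *\<^sub>R w = 0"
      using \<open>collinear_vectors u w\<close> by (auto simp: collinear_vectors_def)
    then have "(a \<noteq> 0 \<or> - b \<noteq> 0) \<and> a *\<^sub>R u + (- b) *\<^sub>R (- w) = 0"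
      by simp
    then show ?thesis
      unfolding collinear_vectors_def by blast
  qed
  from this[of v] this[of "- v"] show ?thesis
    by auto
qed

lemma tendsto_quotient_at_right_iff:
  "(normalized_difference_quotient x y z t0 \<longlongrightarrow> u) (at_right 0) \<longleftrightarrow>
   ((\<lambda>t. secant_direction (space_curve x y z t0) (space_curve x y z t)) \<longlongrightarrow> u) (at_right t0)"
proof -
  have "eventually (\<lambda>dt. normalized_difference_quotient x y z t0 dt =
      secant_direction (space_curve x y z t0) (space_curve x y z (dt + t0))) (at_right 0)"
    by (auto simp: eventually_at_filter normalized_difference_quotient_eq add.commute)
  from tendsto_cong[OF this] show ?thesis
    by (simp add: filterlim_at_right_to_0[of _ _ t0])
qed

lemma filterlim_at_left_to_0:
  fixes a :: real
  shows "filterlim f F (at_left a) \<longleftrightarrow> filterlim (\<lambda>x. f (x + a)) F (at_left 0)"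
proof -
  have "nhds a = filtermap (\<lambda>x. x + a) (nhds 0)"
    using filtermap_nhds_shift[of "- a" 0] by simp
  then have "at_left a = filtermap (\<lambda>x. x + a) (at_left 0)"
    by (intro filter_eqI) (simp add: eventually_filtermap eventually_at_filter)
  then show ?thesis
    by (simp add: filterlim_filtermap)
qed

lemma tendsto_quotient_at_left_iff:
  "(normalized_difference_quotient x y z t0 \<longlongrightarrow> v) (at_left 0) \<longleftrightarrow>
   ((\<lambda>t. secant_direction (space_curve x y z t0) (space_curve x y z t)) \<longlongrightarrow> - v) (at_left t0)"
proof -
  have "eventually (\<lambda>dt. normalized_difference_quotient x y z t0 dt =
      - secant_direction (space_curve x y z t0) (space_curve x y z (dt + t0))) (at_left 0)"
    by (auto simp: eventually_at_filter normalized_difference_quotient_eq add.commute)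
  from tendsto_cong[OF this] show ?thesis
    by (simp add: filterlim_at_left_to_0[of _ _ t0] tendsto_minus_cancel_left)
qed

theorem theorem3p1:
  fixes x y z :: "real \<Rightarrow> real" and I :: "real set" and t0 \<delta> :: real
    and A :: "real^3" and L L1 L2 :: "(real^3) set"
  assumes "open I" and "is_interval I" and "t0 \<in> I"
    and "continuous_on I x" and "continuous_on I y" and "continuous_on I z"
    and "L = space_curve x y z ` I"
    and "A = space_curve x y z t0"
    and "\<delta> > 0" and "{t0 - \<delta>..t0 + \<delta>} \<subseteq> I"
    and "L1 = space_curve x y z ` {t0..t0 + \<delta>}"
    and "L2 = space_curve x y z ` {t0 - \<delta>..t0}"
    and "L1 \<inter> L2 = {A}"
    and "\<And>t. 0 < \<bar>t - t0\<bar> \<Longrightarrow> \<bar>t - t0\<bar> \<le> \<delta> \<Longrightarrow> space_curve x y z t \<noteq> A"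
  shows "has_tangent_at L A L1 L2 \<longleftrightarrow>
    (\<exists>u v. (normalized_difference_quotient x y z t0 \<longlongrightarrow> u) (at_right 0) \<and>
           (normalized_difference_quotient x y z t0 \<longlongrightarrow> v) (at_left 0) \<and>
           collinear_vectors u v)"
proof -
  let ?p = "space_curve x y z"
  note \<delta> = \<open>\<delta> > 0\<close> and avoid = assms(14)
  have cont: "continuous_on {t0 - \<delta>..t0 + \<delta>} ?p"
    using assms(4-6,10) by (meson continuous_on_space_curve continuous_on_subset)
  have right: "(secant_direction A \<longlongrightarrow> u) (at A within L1) \<longleftrightarrow>
      (normalized_difference_quotient x y z t0 \<longlongrightarrow> u) (at_right 0)" for u
  proof -
    have "continuous_on {t0..t0 + \<delta>} ?p"
      using cont by (rule continuous_on_subset) (use \<delta> in auto)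
    moreover have "?p t \<noteq> ?p t0" if "t \<in> {t0..t0 + \<delta>}" "t \<noteq> t0" for t
      using avoid[of t] that \<open>A = ?p t0\<close> by auto
    ultimately have "(secant_direction A \<longlongrightarrow> u) (at A within L1) \<longleftrightarrow>
        ((\<lambda>t. secant_direction A (?p t)) \<longlongrightarrow> u) (at t0 within {t0..t0 + \<delta>})"
      using \<delta> unfolding \<open>L1 = _\<close> \<open>A = ?p t0\<close> by (intro filterlim_compose_at_within_compact) auto
    then show ?thesis
      using \<delta> by (simp add: at_within_Icc_at_right tendsto_quotient_at_right_iff \<open>A = ?p t0\<close>)
  qed
  have left: "(secant_direction A \<longlongrightarrow> - v) (at A within L2) \<longleftrightarrow>
      (normalized_difference_quotient x y z t0 \<longlongrightarrow> v) (at_left 0)" for v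
  proof -
    have "continuous_on {t0 - \<delta>..t0} ?p"
      using cont by (rule continuous_on_subset) (use \<delta> in auto)
    moreover have "?p t \<noteq> ?p t0" if "t \<in> {t0 - \<delta>..t0}" "t \<noteq> t0" for t
      using avoid[of t] that \<open>A = ?p t0\<close> by auto
    ultimately have "(secant_direction A \<longlongrightarrow> - v) (at A within L2) \<longleftrightarrow>
        ((\<lambda>t. secant_direction A (?p t)) \<longlongrightarrow> - v) (at t0 within {t0 - \<delta>..t0})"
      using \<delta> unfolding \<open>L2 = _\<close> \<open>A = ?p t0\<close> by (intro filterlim_compose_at_within_compact) auto
    then show ?thesis
      using \<delta> by (simp add: at_within_Icc_at_left tendsto_quotient_at_left_iff \<open>A = ?p t0\<close>)
  qed
  have "?p (t0 + \<delta>) \<in> L1" "?p (t0 + \<delta>) \<noteq> A" "?p (t0 - \<delta>) \<in> L2" "?p (t0 - \<delta>) \<noteq> A"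
    using \<delta> avoid[of "t0 + \<delta>"] avoid[of "t0 - \<delta>"] \<open>L1 = _\<close> \<open>L2 = _\<close> by auto
  moreover have "\<exists>(p :: real \<Rightarrow> real^3) a b c. a \<le> c \<and> c \<le> b \<and> continuous_on {a..b} p \<and>
      p ` {a..b} \<subseteq> L \<and> p c = A \<and> L1 = p ` {c..b} \<and> L2 = p ` {a..c}"
    using \<delta> cont assms(7,8,10-12)
    by (intro exI[of _ ?p] exI[of _ "t0 - \<delta>"] exI[of _ "t0 + \<delta>"] exI[of _ t0]) auto
  ultimately have "divides_arc L A L1 L2"
    unfolding divides_arc_def using \<open>L1 \<inter> L2 = {A}\<close> by blast
  then show ?thesis
    unfolding has_tangent_at_def right left[symmetric]
    by (metis collinear_vectors_minus_right minus_minus)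
qed

end
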